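(* Let $(a_n)_{n\ge0}$ be a sequence of complex numbers with $a_0=0$, let $b_n=a_n-a_{n-1}$ for $n\ge1$, and for integers $k\ge0$ set $$\Phi_k(x)=\sum_{n\ge1}a_n n^k x^n,\qquad \varphi_k(x)=\sum_{n\ge1}b_n n^k x^n .$$ Then for every integer $k\ge0$, as formal power series in $x$, $$\Phi_k(x)=\varphi_k(x)+\sum_{j=0}^k\binom{k}{j}\mathrm{Li}_{j-k}(x)\,\varphi_j(x).$$
   Context: $\mathrm{Li}_s(x)=\sum_{n\ge1}x^n n^{-s}$ is the polylogarithm; for nonpositive integers $s$ it is a rational function of $x$ (e.g. $\mathrm{Li}_0(x)=x/(1-x)$). *)

theory Defs
  imports Complex_Main "HOL-Computational_Algebra.Formal_Power_Series"
begin

definition Li_fps :: "int \<Rightarrow> complex fps" where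
  "Li_fps s = Abs_fps (\<lambda>n. if n = 0 then 0 else of_nat n powi (- s))"

text \<open>
  \<^term>\<open>moment_fps c k\<close> is the series of \<open>c n * n ^ k * x ^ n\<close> over \<open>n \<ge> 1\<close>.
  The explicit case \<open>n = 0\<close> matters for \<open>k = 0\<close>, since \<open>0 ^ 0 = 1\<close>.
\<close>
definition moment_fps :: "(nat \<Rightarrow> complex) \<Rightarrow> nat \<Rightarrow> complex fps" where
  "moment_fps c k = Abs_fps (\<lambda>n. if n = 0 then 0 else c n * of_nat n ^ k)"

lemma Li_fps_0: "Li_fps 0 = fps_X / (1 - fps_X)"
proof -
  have "Li_fps 0 * (1 - fps_X) = fps_X"
    by (rule fps_ext) (auto simp: Li_fps_def right_diff_distrib)
  moreover have "(1 - fps_X :: complex fps) \<noteq> 0"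
    by (metis diff_eq_diff_eq diff_self fps_X_neq_one)
  ultimately show ?thesis
    by (metis nonzero_mult_div_cancel_right)
qed

end

theory Submission
  imports Defs
begin

unbundle fps_syntax

text \<open>
  By telescoping, \<open>a n = b 1 + \<dots> + b n\<close>. Splitting \<open>n = (n - m) + m\<close> and expanding
  \<open>b m * n ^ k\<close> by the binomial theorem exhibits the terms with \<open>m < n\<close> as the coefficient of
  a sum of Cauchy products; the term \<open>m = n\<close> gives the extra summand.
\<close>

text \<open>The case \<open>n = 0\<close> cannot be absorbed into the power: for
  \<open>j = k\<close> that would give \<open>0 ^ 0 = 1\<close>.\<close>

lemma Li_fps_nth_diff:
  assumes "j \<le> k"
  shows "Li_fps (int j - int k) $ n = (if n = 0 then 0 else of_nat n ^ (k - j))"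
proof -
  have "- (int j - int k) = int (k - j)"
    using assms by simp
  then show ?thesis
    by (simp only: Li_fps_def fps_nth_Abs_fps power_int_of_nat)
qed

lemma Li_fps_moment_fps_convolution_nth:
  "(\<Sum>j=0..k. of_nat (k choose j) * Li_fps (int j - int k) * moment_fps c j) $ n =
    (\<Sum>m\<in>{1..<n}. c m) * of_nat n ^ k"
proof -
  \<comment> \<open>With the sums interchanged, \<open>m\<close> is fixed and the sum over
    \<open>j\<close> is the binomial expansion of \<open>(m + (n - m)) ^ k\<close>.\<close>
  have binom: "(\<Sum>j=0..k. of_nat (k choose j) *
        (moment_fps c j $ m * Li_fps (int j - int k) $ (n - m))) =
      (if m \<in> {1..<n} then c m * of_nat n ^ k else 0)" if "m \<le> n" for m
  proof (cases "m \<in> {1..<n}")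
    case True
    have "of_nat n ^ k = (of_nat m + of_nat (n - m) :: complex) ^ k"
      using that by (simp flip: of_nat_add)
    also have "\<dots> = (\<Sum>j=0..k. of_nat (k choose j) * of_nat m ^ j * of_nat (n - m) ^ (k - j))"
      by (simp only: binomial_ring atMost_atLeast0)
    finally show ?thesis
      using True
      by (auto simp: moment_fps_def Li_fps_nth_diff sum_distrib_left mult_ac intro!: sum.cong)
  next
    case False
    \<comment> \<open>Both series have zero constant term, so one factor vanishes at either
      endpoint. Losing \<open>m = n\<close> is what makes the separate summand
      \<open>moment_fps b k\<close> necessary.\<close>
    then have "m = 0 \<or> n - m = 0" by auto
    with False show ?thesis
      by (auto simp: moment_fps_def Li_fps_nth_diff intro!: sum.neutral)
  qed
  have "(\<Sum>j=0..k. of_nat (k choose j) * Li_fps (int j - int k) * moment_fps c j) $ n =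
      (\<Sum>j=0..k. of_nat (k choose j) *
        (\<Sum>m=0..n. moment_fps c j $ m * Li_fps (int j - int k) $ (n - m)))"
    \<comment> \<open>The factors are swapped so that the Cauchy index \<open>m\<close> is the
      argument of \<open>c\<close>.\<close>
    by (simp add: fps_sum_nth mult.assoc mult.commute[of "Li_fps _"] fps_mult_nth[of "moment_fps _ _"]
        flip: fps_of_nat)
  also have "\<dots> = (\<Sum>m=0..n. \<Sum>j=0..k. of_nat (k choose j) *
        (moment_fps c j $ m * Li_fps (int j - int k) $ (n - m)))"
    by (subst sum.swap) (simp add: sum_distrib_left)
  also have "\<dots> = (\<Sum>m=0..n. if m \<in> {1..<n} then c m * of_nat n ^ k else 0)"
    by (intro sum.cong refl binom) simp
  also have "\<dots> = (\<Sum>m\<in>{1..<n}. c m * of_nat n ^ k)"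
    by (intro sum.mono_neutral_cong_right) auto
  finally show ?thesis
    by (simp add: sum_distrib_right)
qed

theorem theorem10:
  fixes a b :: "nat \<Rightarrow> complex" and k :: nat
  assumes "a 0 = 0"
    and "\<And>n. n \<ge> 1 \<Longrightarrow> b n = a n - a (n - 1)"
  shows "moment_fps a k =
    moment_fps b k +
    (\<Sum>j=0..k. of_nat (k choose j) * Li_fps (int j - int k) * moment_fps b j)"
proof (rule fps_ext)
  fix n
  have telescope: "a m = (\<Sum>i\<in>{1..<Suc m}. b i)" for m
    by (induction m) (simp_all add: assms)
  \<comment> \<open>At \<open>n = 0\<close> this could fail, as \<open>b 0\<close> is arbitrary;
    there both sides of the goal have coefficient zero.\<close>
  have "a n = b n + (\<Sum>i\<in>{1..<n}. b i)" if "n \<noteq> 0"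
    using that telescope[of n] by (simp add: add.commute)
  then show "moment_fps a k $ n = (moment_fps b k +
      (\<Sum>j=0..k. of_nat (k choose j) * Li_fps (int j - int k) * moment_fps b j)) $ n"
    unfolding fps_add_nth Li_fps_moment_fps_convolution_nth
    by (simp add: moment_fps_def distrib_right)
qed

end
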